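(* Let $S\subseteq V'$. For every route $p=(i_1,\dots,i_{K+1})\in P$ with labels $L_1,\dots,L_{K+1}$ along the route, $$\mathbb{I}(|p\cap S|\ge 1)\;\le\;\sum_{k=1}^K\mathbb{I}(i_k\notin S,\,i_{k+1}\in S)\,\mathbb{I}(\Pi(L_k)\cap S=\emptyset)\;\le\;\sum_{k=1}^K\mathbb{I}(i_k\notin S,\,i_{k+1}\in S).$$ Consequently, the $ng$-capacity cut $$\sum_{p\in P}\Big(\sum_{k=1}^K\mathbb{I}(i_k\notin S,\,i_{k+1}\in S)\,\mathbb{I}(\Pi(L_k)\cap S=\emptyset)\Big)x_p\ge\Big\lceil\tfrac1Q\sum_{i\in S}q_i\Big\rceil$$ is a valid inequality (it is satisfied by every feasible binary solution), and it dominates the rounded capacity cut $$\sum_{p\in P}\Big(\sum_{(i,j)\in p}\mathbb{I}(i\notin S,\,j\in S)\Big)x_p\ge\Big\lceil\tfrac1Q\sum_{i\in S}q_i\Big\rceil ,$$ in the sense that every $x\ge 0$ satisfying the former satisfies the latter. Moreover, when the $ng$-route relaxation is used, the $ng$-capacity cut admits a resource-robust application, with functions $$g_{ij}(R)=\mathbb{I}(i\notin S,\,j\in S)\,\mathbb{I}(\Pi(R)\cap S=\emptyset),\qquad (i,j)\in A.$$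
   Context: Let $G=(V,A)$ be a directed graph with $V=\{0,1,\dots,n+1\}$, where $0$ is the starting depot, $n+1$ the ending depot, and $V'=\{1,\dots,n\}$ the customers. Arcs go from $0$ to customers, between customers, and from customers to $n+1$. $P$ is a set of routes (paths, possibly with cycles) from $0$ to $n+1$ in $G$; sums over $i\in p$ or $(i,j)\in p$ repeat vertices or arcs with multiplicity; $|p\cap S|\ge1$ means that $p$ visits some vertex of $S$. Let $a_p^i$ be the number of times $p$ visits $i\in V'$. Each customer $i\in V'$ has demand $q_i\ge0$, vehicles have capacity $Q>0$, and each $p\in P$ satisfies $\sum_{i\in p}q_i\le Q$ (with depots having demand $0$). A feasible binary solution is $x\in\{0,1\}^P$ with $\sum_{p\in P}a_p^ix_p=1$ for all $i\in V'$. $\mathbb{I}(\cdot)$ is the indicator function. Resources: the routes in $P$ are the feasible routes of a shortest path problem with resource constraints (SPPRC) with resource vectors in $\mathbb{R}^m$, updated along each arc $(i,j)\in A$ by a non-decreasing resource extension function $F_{ij}:\mathbb{R}^m\to\mathbb{R}^m$ (after extension to $j$ the new resource vector is $\max\{l_j,F_{ij}(R)\}$, taken componentwise, which must be at most $u_j$ for given bounds $l_j,u_j\in\mathbb{R}^m$). The label $L_k$ at the $k$th vertex $i_k$ of a route $p=(i_1,\dots,i_{K+1})$, with $i_1=0$ and $i_{K+1}=n+1$, carries the resource vector $R_k$ of the partial route $(i_1,\dots,i_k)$. $ng$-route relaxation: for each $i\in V'$ a neighborhood $N_i\subseteq V'$ with $i\in N_i$ is given. Among the $m$ resources there are $|V'|$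 binary resources, one per customer, and the $ng$-memory $\Pi(L)\subseteq V'$ of a label $L$ is the set of customers whose $ng$-resource equals one; for a resource vector $R\in\mathbb{R}^m$, $\Pi(R)\subseteq V'$ denotes the $ng$-memory associated with $R$, and on general real vectors $\Pi(R)$ is the set of customers whose $ng$-resource in $R$ is at least $1$, so that $R\le R'$ (componentwise) implies $\Pi(R)\subseteq\Pi(R')$. The $ng$-memory is initially $\emptyset$ at vertex $0$, and an extension of $L$ to $L'$ over an arc $(i,j)$ with $j\in V'$ gives $\Pi(L')=(\Pi(L)\cap N_j)\cup\{j\}$ and is allowed only if $j\notin\Pi(L)$. Resource-robust application: an inequality $\sum_{p\in P}g_px_p\ge h$ admits a resource-robust application if there exist non-increasing functions $g_{ij}:\mathbb{R}^m\to\mathbb{R}$, $(i,j)\in A$ (i.e. $R\le R'$ componentwise implies $g_{ij}(R)\ge g_{ij}(R')$), such that $g_p=\sum_{k=1}^Kg_{i_ki_{k+1}}(R_k)$ for every $p=(i_1,\dots,i_{K+1})\in P$ with resource vectors $(R_1,\dots,R_{K+1})$ along the route as defined by the SPPRC. *)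

theory Defs
  imports "HOL-Analysis.Analysis"
begin

section \<open>Shortest path problem with resource constraints\<close>

text \<open>
  The vertices are the numbers from 0 to n + 1, with start depot 0 and end depot n + 1.  Resource
  vectors live in \<open>real^'m\<close>, whose library order is the componentwise one.
\<close>

record 'm spprc =
  ncust :: nat
  arcs  :: "(nat \<times> nat) set"
  ref   :: "nat \<Rightarrow> nat \<Rightarrow> real^'m \<Rightarrow> real^'m"
  lower :: "nat \<Rightarrow> real^'m"
  upper :: "nat \<Rightarrow> real^'m"
  start :: "real^'m"

definition customers :: "('m::finite) spprc \<Rightarrow> nat set" where
  "customers G = {1..ncust G}"

definition wf_spprc :: "('m::finite) spprc \<Rightarrow> bool" where
  "wf_spprc G \<longleftrightarrow>
     arcs G \<subseteq> ({0} \<times> customers G) \<union> (customers G \<times> customers G)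
               \<union> (customers G \<times> {ncust G + 1}) \<and>
     (\<forall>(i, j) \<in> arcs G. mono (ref G i j))"

text \<open>On \<open>real^'m\<close>, \<open>sup\<close> is the componentwise maximum.\<close>

definition extend :: "('m::finite) spprc \<Rightarrow> nat \<Rightarrow> nat \<Rightarrow> real^'m \<Rightarrow> real^'m" where
  "extend G i j R = sup (lower G j) (ref G i j R)"

text \<open>
  Paths are vertex lists and positions are counted from 0: the vertex \<open>p ! k\<close> is the paper's
  \<open>i\<^sub>k\<^sub>+\<^sub>1\<close>, and \<open>resources G p k\<close> is the resource vector of the label there; it depends only on the
  first \<open>k + 1\<close> vertices of \<open>p\<close>.
\<close>

primrec resources :: "('m::finite) spprc \<Rightarrow> nat list \<Rightarrow> nat \<Rightarrow> real^'m" where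
  "resources G p 0 = start G"
| "resources G p (Suc k) = extend G (p ! k) (p ! Suc k) (resources G p k)"

definition partial_route :: "('m::finite) spprc \<Rightarrow> nat list \<Rightarrow> bool" where
  "partial_route G p \<longleftrightarrow>
     p \<noteq> [] \<and> hd p = 0 \<and>
     (\<forall>k. Suc k < length p \<longrightarrow>
        (p ! k, p ! Suc k) \<in> arcs G \<and> resources G p (Suc k) \<le> upper G (p ! Suc k))"

definition feasible_routes :: "('m::finite) spprc \<Rightarrow> nat list set" where
  "feasible_routes G = {p. partial_route G p \<and> last p = ncust G + 1}"

section \<open>The ng-route relaxation\<close>

text \<open>\<open>\<rho> i\<close> is the index of the ng-resource of customer \<open>i\<close>.\<close>

definition ng_memory :: "('m::finite) spprc \<Rightarrow> (nat \<Rightarrow> 'm) \<Rightarrow> real^'m \<Rightarrow> nat set" where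
  "ng_memory G \<rho> R = {i \<in> customers G. R $ \<rho> i \<ge> 1}"

text \<open>
  The resource extension functions are not fixed; they are only required to realise the
  ng-rules on the labels of feasible partial routes, where the ng-resources are binary, so that
  there \<open>\<ge> 1\<close> in \<open>ng_memory\<close> means \<open>= 1\<close>.
\<close>

definition ng_relaxation ::
    "('m::finite) spprc \<Rightarrow> (nat \<Rightarrow> 'm) \<Rightarrow> (nat \<Rightarrow> nat set) \<Rightarrow> bool" where
  "ng_relaxation G \<rho> N \<longleftrightarrow>
     inj_on \<rho> (customers G) \<and>
     (\<forall>i \<in> customers G. N i \<subseteq> customers G \<and> i \<in> N i) \<and>
     (\<forall>p k i. partial_route G p \<and> k < length p \<and> i \<in> customers G \<longrightarrow>
        resources G p k $ \<rho> i \<in> {0, 1}) \<and>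
     ng_memory G \<rho> (start G) = {} \<and>
     (\<forall>p k. partial_route G p \<and> Suc k < length p \<and> p ! Suc k \<in> customers G \<longrightarrow>
        p ! Suc k \<notin> ng_memory G \<rho> (resources G p k) \<and>
        ng_memory G \<rho> (resources G p (Suc k)) =
          (ng_memory G \<rho> (resources G p k) \<inter> N (p ! Suc k)) \<union> {p ! Suc k})"

section \<open>Inequalities in the route variables\<close>

text \<open>
  An inequality \<open>\<Sum>p\<in>P. g p * x p \<ge> h\<close> is given by \<open>g\<close> and \<open>h\<close>.  The set \<open>P\<close> may be infinite;
  points are then finitely supported, which is no restriction if \<open>P\<close> is finite.
\<close>

definition support :: "nat list set \<Rightarrow> (nat list \<Rightarrow> real) \<Rightarrow> nat list set" where
  "support P x = {p \<in> P. x p \<noteq> 0}"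

definition lhs :: "nat list set \<Rightarrow> (nat list \<Rightarrow> real) \<Rightarrow> (nat list \<Rightarrow> real) \<Rightarrow> real" where
  "lhs P g x = (\<Sum>p \<in> support P x. g p * x p)"

definition feasible_binary ::
    "('m::finite) spprc \<Rightarrow> nat list set \<Rightarrow> (nat list \<Rightarrow> real) \<Rightarrow> bool" where
  "feasible_binary G P x \<longleftrightarrow>
     finite (support P x) \<and> (\<forall>p \<in> P. x p \<in> {0, 1}) \<and>
     (\<forall>i \<in> customers G. lhs P (\<lambda>p. real (count_list p i)) x = 1)"

definition valid_inequality ::
    "('m::finite) spprc \<Rightarrow> nat list set \<Rightarrow> (nat list \<Rightarrow> real) \<Rightarrow> real \<Rightarrow> bool" where
  "valid_inequality G P g h \<longleftrightarrow> (\<forall>x. feasible_binary G P x \<longrightarrow> lhs P g x \<ge> h)"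

definition dominates ::
    "nat list set \<Rightarrow> (nat list \<Rightarrow> real) \<Rightarrow> real \<Rightarrow> (nat list \<Rightarrow> real) \<Rightarrow> real \<Rightarrow> bool" where
  "dominates P g h g' h' \<longleftrightarrow>
     (\<forall>x. finite (support P x) \<and> (\<forall>p \<in> P. x p \<ge> 0) \<and> lhs P g x \<ge> h \<longrightarrow> lhs P g' x \<ge> h')"

text \<open>
  The right-hand side \<open>h\<close> of the inequality plays no role in resource-robustness.
\<close>

definition resource_robust_by ::
    "('m::finite) spprc \<Rightarrow> nat list set \<Rightarrow> (nat \<Rightarrow> nat \<Rightarrow> real^'m \<Rightarrow> real)
      \<Rightarrow> (nat list \<Rightarrow> real) \<Rightarrow> bool" where
  "resource_robust_by G P \<gamma> g \<longleftrightarrow>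
     (\<forall>(i, j) \<in> arcs G. antimono (\<gamma> i j)) \<and>
     (\<forall>p \<in> P. g p = (\<Sum>k < length p - 1. \<gamma> (p ! k) (p ! Suc k) (resources G p k)))"

definition admits_resource_robust_application ::
    "('m::finite) spprc \<Rightarrow> nat list set \<Rightarrow> (nat list \<Rightarrow> real) \<Rightarrow> bool" where
  "admits_resource_robust_application G P g \<longleftrightarrow> (\<exists>\<gamma>. resource_robust_by G P \<gamma> g)"

section \<open>Capacity cuts\<close>

definition capacity_coeff :: "nat set \<Rightarrow> nat list \<Rightarrow> real" where
  "capacity_coeff S p = (\<Sum>k < length p - 1. of_bool (p ! k \<notin> S \<and> p ! Suc k \<in> S))"

definition ng_capacity_coeff ::
    "('m::finite) spprc \<Rightarrow> (nat \<Rightarrow> 'm) \<Rightarrow> nat set \<Rightarrow> nat list \<Rightarrow> real" where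
  "ng_capacity_coeff G \<rho> S p =
     (\<Sum>k < length p - 1. of_bool (p ! k \<notin> S \<and> p ! Suc k \<in> S) *
        of_bool (ng_memory G \<rho> (resources G p k) \<inter> S = {}))"

definition capacity_rhs :: "(nat \<Rightarrow> real) \<Rightarrow> real \<Rightarrow> nat set \<Rightarrow> real" where
  "capacity_rhs q Q S = of_int \<lceil>(\<Sum>i \<in> S. q i) / Q\<rceil>"

end

(*
  The ng-memory along a route only ever contains visited customers.  Hence at the arc on which a
  route enters S for the first time the memory is still disjoint from S, and this arc contributes 1
  to the ng-capacity coefficient.  By the capacity restriction the selected routes that visit S
  number at least (sum of q over S) / Q, and since their number is an integer the bound may be
  rounded up.
*)

theory Submission
  imports Defs
begin

lemma arcs_vertices:
  assumes "wf_spprc G" "(i, j) \<in> arcs G"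
  shows "i \<in> insert 0 (customers G)" "j \<in> insert (ncust G + 1) (customers G)"
  using assms unfolding wf_spprc_def by auto

lemma partial_route_arc:
  "partial_route G p \<Longrightarrow> Suc k < length p \<Longrightarrow> (p ! k, p ! Suc k) \<in> arcs G"
  by (simp add: partial_route_def)

lemma partial_route_nth_0: "partial_route G p \<Longrightarrow> p ! 0 = 0"
  by (metis hd_conv_nth partial_route_def)

lemma set_partial_route:
  assumes "wf_spprc G" "partial_route G p"
  shows "set p \<subseteq> insert 0 (insert (ncust G + 1) (customers G))"
proof
  fix v assume "v \<in> set p"
  then obtain k where k: "k < length p" "v = p ! k"
    by (auto simp: in_set_conv_nth)
  show "v \<in> insert 0 (insert (ncust G + 1) (customers G))"
  proof (cases k)
    case 0
    then show ?thesis using k partial_route_nth_0[OF assms(2)] by simp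
  next
    case (Suc l)
    then show ?thesis
      using k arcs_vertices(2)[OF assms(1) partial_route_arc[OF assms(2), of l]] by auto
  qed
qed

text \<open>An inner vertex is the head of one arc and the tail of the next. Being a head excludes
  the start depot, and being a tail excludes the end depot.\<close>

lemma inner_vertex_is_customer:
  assumes "wf_spprc G" "partial_route G p" "Suc (Suc k) < length p"
  shows "p ! Suc k \<in> customers G"
  using arcs_vertices(1)[OF assms(1) partial_route_arc[OF assms(2), of "Suc k"]]
    arcs_vertices(2)[OF assms(1) partial_route_arc[OF assms(2), of k]] assms(3)
  by (auto simp: customers_def)

text \<open>Each extension can only shrink the memory and add the vertex just reached. The last
  position is left out because it may be the end depot, for which the ng-rules prescribe no
  update.\<close>

lemma ng_memory_subset_visited:
  assumes "wf_spprc G" "ng_relaxation G \<rho> N" "partial_route G p" "Suc k < length p"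
  shows "ng_memory G \<rho> (resources G p k) \<subseteq> (\<lambda>j. p ! j) ` {..k}"
  using assms(4)
proof (induction k)
  case 0
  then show ?case using assms(2) by (simp add: ng_relaxation_def)
next
  case (Suc k)
  have "ng_memory G \<rho> (resources G p (Suc k)) =
      (ng_memory G \<rho> (resources G p k) \<inter> N (p ! Suc k)) \<union> {p ! Suc k}"
    using assms(2,3) inner_vertex_is_customer[OF assms(1,3) Suc.prems] Suc.prems
    unfolding ng_relaxation_def by (meson Suc_lessD)
  then show ?case
    using Suc.IH Suc.prems by (auto simp: atMost_Suc)
qed

text \<open>The memory is cut out by thresholds \<open>\<ge> 1\<close> on components, so it grows
  with the resource vector, also outside binary values.\<close>

lemma ng_memory_mono: "R \<le> R' \<Longrightarrow> ng_memory G \<rho> R \<subseteq> ng_memory G \<rho> R'"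
  unfolding ng_memory_def less_eq_vec_def by (auto intro: order_trans)

lemma indicator_le_ng_capacity_coeff:
  assumes "wf_spprc G" "ng_relaxation G \<rho> N" "partial_route G p" "S \<subseteq> customers G"
  shows "of_bool (set p \<inter> S \<noteq> {}) \<le> ng_capacity_coeff G \<rho> S p"
proof (cases "set p \<inter> S = {}")
  case True
  then show ?thesis by (simp add: ng_capacity_coeff_def sum_nonneg)
next
  case False
  define P where "P k \<longleftrightarrow> k < length p \<and> p ! k \<in> S" for k
  obtain k' where "P k'"
    using False unfolding P_def by (metis disjoint_iff in_set_conv_nth)
  \<comment> \<open>Routes start at the depot, which is not in \<open>S\<close>. So the first
    position in \<open>S\<close> has the form \<open>Suc k\<close>, and the arc from
    \<open>k\<close> to \<open>Suc k\<close> is the first entry into \<open>S\<close>.\<close>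
  moreover have "\<not> P 0"
    using partial_route_nth_0[OF assms(3)] assms(4) by (auto simp: P_def customers_def)
  ultimately obtain k where k: "\<not> P k" "P (Suc k)" "\<And>j. j \<le> k \<Longrightarrow> \<not> P j"
    using ex_least_nat_less[of P k'] by auto
  define f :: "nat \<Rightarrow> real" where "f k = of_bool (p ! k \<notin> S \<and> p ! Suc k \<in> S) *
        of_bool (ng_memory G \<rho> (resources G p k) \<inter> S = {})" for k
  have len: "Suc k < length p" using k(2) by (simp add: P_def)
  have "p ! j \<notin> S" if "j \<le> k" for j
    using k(3)[OF that] that len by (simp add: P_def)
  \<comment> \<open>The memory at \<open>k\<close> consists of vertices at positions up to
    \<open>k\<close>, all outside \<open>S\<close>, so both indicators are 1.\<close>
  then have "f k = 1"
    using ng_memory_subset_visited[OF assms(1-3) len] k(2) by (auto simp: f_def P_def)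
  moreover have "f k \<le> (\<Sum>k < length p - 1. f k)"
    using len by (intro member_le_sum) (auto simp: f_def)
  ultimately show ?thesis
    using False by (simp add: ng_capacity_coeff_def f_def)
qed

lemma ng_capacity_coeff_le_capacity_coeff: "ng_capacity_coeff G \<rho> S p \<le> capacity_coeff S p"
  unfolding ng_capacity_coeff_def capacity_coeff_def by (intro sum_mono) auto

lemma lhs_mono:
  assumes "\<And>p. p \<in> P \<Longrightarrow> f p \<le> g p" "\<And>p. p \<in> P \<Longrightarrow> x p \<ge> 0"
  shows "lhs P f x \<le> lhs P g x"
  unfolding lhs_def by (intro sum_mono mult_right_mono) (auto simp: support_def assms)

text \<open>With equal right-hand sides and \<open>x\<close> nonnegative, comparing the coefficients
  route by route is enough.\<close>

lemma dominatesI: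
  assumes "\<And>p. p \<in> P \<Longrightarrow> g p \<le> g' p"
  shows "dominates P g h g' h"
  unfolding dominates_def by (meson assms lhs_mono order_trans)

text \<open>Every occurrence of a vertex of \<open>S\<close> in \<open>p\<close> contributes its
  weight to both sides; the other occurrences add nonnegative weights on the right only.\<close>

lemma sum_count_list_mult_le_sum_list:
  fixes q :: "'a \<Rightarrow> real"
  assumes "finite S" "\<And>i. i \<in> set p \<Longrightarrow> q i \<ge> 0"
  shows "(\<Sum>i\<in>S. q i * count_list p i) \<le> sum_list (map q p)"
  using assms(2)
proof (induction p)
  case Nil
  then show ?case by simp
next
  case (Cons a p)
  have "(\<Sum>i\<in>S. q i * count_list (a # p) i) =
      (\<Sum>i\<in>S. q i * count_list p i + (if i = a then q i else 0))"
    by (intro sum.cong) (auto simp: algebra_simps)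
  also have "\<dots> = (\<Sum>i\<in>S. q i * count_list p i) + (if a \<in> S then q a else 0)"
    using assms(1) by (simp add: sum.distrib)
  also have "\<dots> \<le> sum_list (map q p) + q a"
    using Cons by (intro add_mono) auto
  finally show ?case by simp
qed

text \<open>The demand of \<open>S\<close> is counted twice: by customer, using that each is covered
  exactly once, and by selected route, using the vehicle capacity.\<close>

lemma capacity_rhs_le_routes_visiting:
  assumes "feasible_binary G P x" "S \<subseteq> customers G" "Q > 0"
    and nonneg: "\<And>p i. p \<in> P \<Longrightarrow> i \<in> set p \<Longrightarrow> q i \<ge> 0"
    and cap: "\<And>p. p \<in> P \<Longrightarrow> sum_list (map q p) \<le> Q"
  shows "capacity_rhs q Q S \<le> lhs P (\<lambda>p. of_bool (set p \<inter> S \<noteq> {})) x"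
proof -
  let ?z = "lhs P (\<lambda>p. of_bool (set p \<inter> S \<noteq> {})) x"
  have x01: "x p \<in> {0, 1}" if "p \<in> support P x" for p
    using assms(1) that by (auto simp: feasible_binary_def support_def)
  have finS: "finite S"
    using assms(2) by (rule finite_subset) (simp add: customers_def)
  \<comment> \<open>A route delivers nothing to \<open>S\<close> if it misses \<open>S\<close>, and
    at most a full vehicle otherwise.\<close>
  have load: "(\<Sum>i\<in>S. q i * count_list p i) \<le> Q * of_bool (set p \<inter> S \<noteq> {})" if "p \<in> P" for p
  proof (cases "set p \<inter> S = {}")
    case True
    then have "count_list p i = 0" if "i \<in> S" for i
      using that by (auto simp: count_list_0_iff)
    then show ?thesis using True by simp
  next
    case False
    then show ?thesis
      using sum_count_list_mult_le_sum_list[of S p q, OF finS nonneg[OF that]] cap[OF that] by simp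
  qed
  \<comment> \<open>Each demand is multiplied by its covering sum, which equals 1; swapping the sums
    then groups the deliveries by route.\<close>
  have "(\<Sum>i\<in>S. q i) = (\<Sum>i\<in>S. q i * lhs P (\<lambda>p. real (count_list p i)) x)"
    using assms(1,2) by (intro sum.cong) (auto simp: feasible_binary_def)
  also have "\<dots> = (\<Sum>p\<in>support P x. (\<Sum>i\<in>S. q i * count_list p i) * x p)"
    unfolding lhs_def sum_distrib_left sum_distrib_right
    by (subst sum.swap) (simp add: mult.assoc)
  also have "\<dots> \<le> (\<Sum>p\<in>support P x. (Q * of_bool (set p \<inter> S \<noteq> {})) * x p)"
    using x01 by (intro sum_mono mult_right_mono load) (force simp: support_def)+
  also have "\<dots> = Q * ?z"
    by (simp add: lhs_def sum_distrib_left mult.assoc)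
  finally have "(\<Sum>i\<in>S. q i) / Q \<le> ?z"
    using assms(3) by (simp add: divide_le_eq mult.commute)
  \<comment> \<open>Integrality of \<open>?z\<close> turns the fractional bound into the one with
    the ceiling.\<close>
  moreover have "?z \<in> \<int>"
    unfolding lhs_def using x01 by (intro Ints_sum Ints_mult) fastforce+
  ultimately show ?thesis
    unfolding capacity_rhs_def by (metis Ints_cases ceiling_le_iff of_int_le_iff)
qed

text \<open>A larger resource vector has a larger memory, so disjointness from \<open>S\<close> can
  only be lost; this makes the functions non-increasing. The coefficient is their sum along the
  route by definition.\<close>

lemma ng_capacity_resource_robust:
  "resource_robust_by G P
     (\<lambda>i j R. of_bool (i \<notin> S \<and> j \<in> S) * of_bool (ng_memory G \<rho> R \<inter> S = {}))
     (ng_capacity_coeff G \<rho> S)"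
  using ng_memory_mono[of _ _ G \<rho>]
  by (fastforce simp: resource_robust_by_def ng_capacity_coeff_def monotone_def)

theorem mainTheorem2:
  fixes G :: "('m::finite) spprc"
    and P :: "nat list set"
    and q :: "nat \<Rightarrow> real" and Q :: real
    and \<rho> :: "nat \<Rightarrow> 'm" and N :: "nat \<Rightarrow> nat set"
    and S :: "nat set"
  assumes "wf_spprc G"
    and "P \<subseteq> feasible_routes G"
    and "\<And>i. i \<in> customers G \<Longrightarrow> q i \<ge> 0"
    and "q 0 = 0" and "q (ncust G + 1) = 0"
    and "Q > 0"
    and "\<And>p. p \<in> P \<Longrightarrow> sum_list (map q p) \<le> Q"
    and "ng_relaxation G \<rho> N"
    and "S \<subseteq> customers G"
  shows "(\<forall>p \<in> P. of_bool (set p \<inter> S \<noteq> {}) \<le> ng_capacity_coeff G \<rho> S p \<and>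
                  ng_capacity_coeff G \<rho> S p \<le> capacity_coeff S p) \<and>
         valid_inequality G P (ng_capacity_coeff G \<rho> S) (capacity_rhs q Q S) \<and>
         dominates P (ng_capacity_coeff G \<rho> S) (capacity_rhs q Q S)
                     (capacity_coeff S) (capacity_rhs q Q S) \<and>
         resource_robust_by G P
           (\<lambda>i j R. of_bool (i \<notin> S \<and> j \<in> S) * of_bool (ng_memory G \<rho> R \<inter> S = {}))
           (ng_capacity_coeff G \<rho> S) \<and>
         admits_resource_robust_application G P (ng_capacity_coeff G \<rho> S)"
proof -
  have route: "partial_route G p" if "p \<in> P" for p
    using assms(2) that by (auto simp: feasible_routes_def)
  have lower: "of_bool (set p \<inter> S \<noteq> {}) \<le> ng_capacity_coeff G \<rho> S p" if "p \<in> P" for p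
    using indicator_le_ng_capacity_coeff[OF assms(1,8) route[OF that] assms(9)] .
  \<comment> \<open>Vertices of a route are customers or depots, and depots have demand 0.\<close>
  have nonneg: "q i \<ge> 0" if "p \<in> P" "i \<in> set p" for p i
    using set_partial_route[OF assms(1) route[OF that(1)]] that(2) assms(3-5) by auto
  have "valid_inequality G P (ng_capacity_coeff G \<rho> S) (capacity_rhs q Q S)"
    unfolding valid_inequality_def
  proof (intro allI impI)
    fix x assume x: "feasible_binary G P x"
    have "x p \<ge> 0" if "p \<in> P" for p
      using x that by (force simp: feasible_binary_def)
    then have "lhs P (\<lambda>p. of_bool (set p \<inter> S \<noteq> {})) x \<le> lhs P (ng_capacity_coeff G \<rho> S) x"
      by (intro lhs_mono lower)
    then show "capacity_rhs q Q S \<le> lhs P (ng_capacity_coeff G \<rho> S) x"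
      using capacity_rhs_le_routes_visiting[OF x assms(9,6), of q] nonneg assms(7)
      by (meson order_trans)
  qed
  then show ?thesis
    unfolding admits_resource_robust_application_def
    using lower ng_capacity_coeff_le_capacity_coeff ng_capacity_resource_robust
    by (blast intro: dominatesI)
qed

end
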